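(* Let $\mathcal X$ be a space of homogeneous type with degree $(\alpha_0,n_0,N_0)$. Let $n\in(n_0,\infty)$, and let $\alpha\in(0,\alpha_0)$ if $\alpha_0>0$ and $\alpha=0$ if $\alpha_0=0$. Assume that $\varphi$ is a growth function on $\mathcal X\times[0,\infty)$ with $\varphi\in\mathbb A_{p_1}(\mathcal X)$ and $\varphi$ of uniformly lower type $p$, where $p_1\in[1,\infty)$ and $p\in(0,1]$. Then there exists a positive constant $C$ such that, for all $f\in\mathrm{BMO}^\varphi(\mathcal X)$, balls $B\subset\mathcal X$ and $K\in(1,\infty)$, $$|f_B-f_{KB}|\le C\,K^{\frac{np_1}p-\alpha}\,\frac{\|\chi_B\|_{L^\varphi(\mathcal X)}}{\mu(B)}\,\|f\|_{\mathrm{BMO}^\varphi(\mathcal X)},$$ where $f_B:=\frac1{\mu(B)}\int_Bf\,d\mu$ and $f_{KB}$ is defined similarly, $KB$ being the ball with the same center as $B$ and $K$ times its radius.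
   Context: **Spaces of homogeneous type.** $(\mathcal X,d,\mu)$: $d:\mathcal X\times\mathcal X\to[0,\infty)$ is a quasi-metric ($d(x,y)=0$ iff $x=y$; $d(x,y)=d(y,x)$; $d(x,y)\le C_1[d(x,z)+d(z,y)]$ for a constant $C_1\in[1,\infty)$), and $\mu$ is a nonnegative Borel measure for which there is $C_2\in[1,\infty)$ with $\mu(B(x,2r))\le C_2\mu(B(x,r))<\infty$ for all balls $B(x,r)=\{y: d(y,x)<r\}$ (balls have positive measure). Consider the conditions: ($D_n$), $n\in(0,\infty)$: $\exists C$ with $\mu(B(x,\lambda r))\le C\lambda^n\mu(B(x,r))$ for all $x\in\mathcal X$, $r>0$, $\lambda\ge1$; ($E_N$), $N\in[0,\infty)$: $\exists C$ with $\mu(B(y,r))\le C[1+d(x,y)/r]^N\mu(B(x,r))$ for all $x,y\in\mathcal X$, $r>0$; ($R_\alpha$), $\alpha\in[0,n]$ with $n$ as in ($D_n$): $\exists C\ge1$ with $C^{-1}\lambda^\alpha\mu(B(x,r))\le\mu(B(x,\lambda r))$ for all $x\in\mathcal X$, $r\in(0,2\,\mathrm{diam}(\mathcal X))$, $\lambda\in[1,2\,\mathrm{diam}(\mathcal X)/r)$. Set $n_0=\inf\{n:(D_n)\}$, $N_0=\inf\{N:(E_N)\}$, $\alpha_0=\sup\{\alpha:(R_\alpha)\}$; $(\alpha_0,n_0,N_0)$ is the degree of $\mathcal X$. **Growth functions.** $\varphi:\mathcal X\times[0,\infty)\to[0,\infty)$ is of uniformly upper type $p$ (resp. uniformly lower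 type $p$) if $\exists C$ with $\varphi(x,st)\le Cs^p\varphi(x,t)$ for all $x\in\mathcal X$, $t\ge0$ and $s\ge1$ (resp. $s\in(0,1)$). For $p\in(1,\infty)$, $\varphi\in\mathbb A_p(\mathcal X)$ means $\sup_{t>0}\sup_{B}\frac1{\mu(B)}\int_B\varphi(x,t)\,d\mu(x)\{\frac1{\mu(B)}\int_B[\varphi(x,t)]^{-1/(p-1)}d\mu(x)\}^{p-1}<\infty$; $\varphi\in\mathbb A_1(\mathcal X)$ means $\sup_{t>0}\sup_B\frac1{\mu(B)}\int_B\varphi(x,t)d\mu(x)\,\{\mathrm{ess\,sup}_{y\in B}[\varphi(y,t)]^{-1}\}<\infty$; $\mathbb A_\infty=\bigcup_{p\in[1,\infty)}\mathbb A_p$ (suprema over all balls $B$). $\varphi$ is a growth function if: for each $x$, $\varphi(x,\cdot)$ is an Orlicz function (nondecreasing, $\varphi(x,0)=0$, $\varphi(x,t)>0$ for $t>0$, $\lim_{t\to\infty}\varphi(x,t)=\infty$; not necessarily convex); $\varphi(\cdot,t)$ is measurable for each $t$; $\varphi\in\mathbb A_\infty(\mathcal X)$; and $\varphi$ is of uniformly upper type $1$ and of uniformly lower type $p$ for some $p\in(0,1]$. $\|f\|_{L^\varphi(\mathcal X)}=\inf\{\lambda>0:\int_{\mathcal X}\varphi(x,|f(x)|/\lambda)\,d\mu(x)\le1\}$; $\chi_B$ is the characteristic function of $B$. **Space.** $\mathrm{BMO}^\varphi(\mathcal X)$: locally integrable $f$ with $\|f\|_{\mathrm{BMO}^\varphi(\mathcal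 X)}=\sup_B\frac1{\|\chi_B\|_{L^\varphi(\mathcal X)}}\int_B|f(x)-f_B|\,d\mu(x)<\infty$, the supremum over all balls $B\subset\mathcal X$. *)

theory Defs
  imports "HOL-Analysis.Analysis" "HOL-Probability.Essential_Supremum"
begin

section \<open>Spaces of homogeneous type\<close>

text \<open>
  The underlying set is \<^term>\<open>space M\<close>; the quasi-metric \<open>d\<close> only matters on it. By a ball we
  always mean the set \<open>qball d M x r\<close> with \<open>x \<in> space M\<close> and \<open>r > 0\<close>, kept together with its
  centre and radius.
\<close>

definition quasi_metric_on :: "'a set \<Rightarrow> ('a \<Rightarrow> 'a \<Rightarrow> real) \<Rightarrow> bool" where
  "quasi_metric_on X d \<longleftrightarrow>
     (\<forall>x\<in>X. \<forall>y\<in>X. 0 \<le> d x y) \<and>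
     (\<forall>x\<in>X. \<forall>y\<in>X. d x y = 0 \<longleftrightarrow> x = y) \<and>
     (\<forall>x\<in>X. \<forall>y\<in>X. d x y = d y x) \<and>
     (\<exists>C1\<ge>1. \<forall>x\<in>X. \<forall>y\<in>X. \<forall>z\<in>X. d x y \<le> C1 * (d x z + d z y))"

definition qball :: "('a \<Rightarrow> 'a \<Rightarrow> real) \<Rightarrow> 'a measure \<Rightarrow> 'a \<Rightarrow> real \<Rightarrow> 'a set" where
  "qball d M x r = {y \<in> space M. d y x < r}"

definition qopen :: "('a \<Rightarrow> 'a \<Rightarrow> real) \<Rightarrow> 'a measure \<Rightarrow> 'a set \<Rightarrow> bool" where
  "qopen d M U \<longleftrightarrow> U \<subseteq> space M \<and> (\<forall>x\<in>U. \<exists>r>0. qball d M x r \<subseteq> U)"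

text \<open>
  The balls of a quasi-metric need not be open, nor even Borel, so their measurability is required
  separately.
\<close>

definition space_of_homogeneous_type :: "('a \<Rightarrow> 'a \<Rightarrow> real) \<Rightarrow> 'a measure \<Rightarrow> bool" where
  "space_of_homogeneous_type d M \<longleftrightarrow>
     quasi_metric_on (space M) d \<and>
     (\<forall>U. qopen d M U \<longrightarrow> U \<in> sets M) \<and>
     (\<forall>x\<in>space M. \<forall>r>0. qball d M x r \<in> sets M \<and> 0 < emeasure M (qball d M x r)) \<and>
     (\<exists>C2\<ge>1. \<forall>x\<in>space M. \<forall>r>0.
        emeasure M (qball d M x (2 * r)) \<le> ennreal C2 * emeasure M (qball d M x r) \<and>
        ennreal C2 * emeasure M (qball d M x r) < \<infinity>)"

definition qdiam :: "('a \<Rightarrow> 'a \<Rightarrow> real) \<Rightarrow> 'a measure \<Rightarrow> ereal" where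
  "qdiam d M = (SUP x\<in>space M. SUP y\<in>space M. ereal (d x y))"

definition cond_D :: "('a \<Rightarrow> 'a \<Rightarrow> real) \<Rightarrow> 'a measure \<Rightarrow> real \<Rightarrow> bool" where
  "cond_D d M n \<longleftrightarrow> 0 < n \<and>
     (\<exists>C. \<forall>x\<in>space M. \<forall>r>0. \<forall>s\<ge>1.
        measure M (qball d M x (s * r)) \<le> C * s powr n * measure M (qball d M x r))"

definition cond_E :: "('a \<Rightarrow> 'a \<Rightarrow> real) \<Rightarrow> 'a measure \<Rightarrow> real \<Rightarrow> bool" where
  "cond_E d M N \<longleftrightarrow> 0 \<le> N \<and>
     (\<exists>C. \<forall>x\<in>space M. \<forall>y\<in>space M. \<forall>r>0.
        measure M (qball d M y r) \<le> C * (1 + d x y / r) powr N * measure M (qball d M x r))"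

definition cond_R :: "('a \<Rightarrow> 'a \<Rightarrow> real) \<Rightarrow> 'a measure \<Rightarrow> real \<Rightarrow> bool" where
  "cond_R d M \<alpha> \<longleftrightarrow> 0 \<le> \<alpha> \<and> (\<exists>n. cond_D d M n \<and> \<alpha> \<le> n) \<and>
     (\<exists>C\<ge>1. \<forall>x\<in>space M. \<forall>r>0. \<forall>s\<ge>1.
        ereal r < 2 * qdiam d M \<and> ereal s < 2 * qdiam d M / ereal r \<longrightarrow>
        inverse C * s powr \<alpha> * measure M (qball d M x r) \<le> measure M (qball d M x (s * r)))"

text \<open>
  The three critical exponents are extended reals: for a one-point space the supremum defining
  the first one is infinite.
\<close>

definition degree_R :: "('a \<Rightarrow> 'a \<Rightarrow> real) \<Rightarrow> 'a measure \<Rightarrow> ereal" where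
  "degree_R d M = (SUP \<alpha>\<in>{\<alpha>. cond_R d M \<alpha>}. ereal \<alpha>)"

definition degree_D :: "('a \<Rightarrow> 'a \<Rightarrow> real) \<Rightarrow> 'a measure \<Rightarrow> ereal" where
  "degree_D d M = (INF n\<in>{n. cond_D d M n}. ereal n)"

definition degree_E :: "('a \<Rightarrow> 'a \<Rightarrow> real) \<Rightarrow> 'a measure \<Rightarrow> ereal" where
  "degree_E d M = (INF N\<in>{N. cond_E d M N}. ereal N)"

definition homogeneous_degree ::
    "('a \<Rightarrow> 'a \<Rightarrow> real) \<Rightarrow> 'a measure \<Rightarrow> ereal \<times> ereal \<times> ereal" where
  "homogeneous_degree d M = (degree_R d M, degree_D d M, degree_E d M)"

section \<open>Growth functions\<close>

text \<open>
  A function \<open>\<phi> : X \<times> [0,\<infinity>) \<rightarrow> [0,\<infinity>)\<close> is a function \<open>\<phi> :: 'a \<Rightarrow> real \<Rightarrow> real\<close> whose values at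
  points outside \<^term>\<open>space M\<close> and at negative arguments are irrelevant.
\<close>

definition unif_upper_type :: "'a measure \<Rightarrow> ('a \<Rightarrow> real \<Rightarrow> real) \<Rightarrow> real \<Rightarrow> bool" where
  "unif_upper_type M \<phi> p \<longleftrightarrow>
     (\<exists>C. \<forall>x\<in>space M. \<forall>t\<ge>0. \<forall>s\<ge>1. \<phi> x (s * t) \<le> C * s powr p * \<phi> x t)"

definition unif_lower_type :: "'a measure \<Rightarrow> ('a \<Rightarrow> real \<Rightarrow> real) \<Rightarrow> real \<Rightarrow> bool" where
  "unif_lower_type M \<phi> p \<longleftrightarrow>
     (\<exists>C. \<forall>x\<in>space M. \<forall>t\<ge>0. \<forall>s\<in>{0<..<1}. \<phi> x (s * t) \<le> C * s powr p * \<phi> x t)"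

text \<open>Only used with a positive exponent.\<close>

definition ennreal_powr :: "ennreal \<Rightarrow> real \<Rightarrow> ennreal" where
  "ennreal_powr a q = (if a = \<infinity> then \<infinity> else ennreal (enn2real a powr q))"

definition muckenhoupt_const ::
    "('a \<Rightarrow> 'a \<Rightarrow> real) \<Rightarrow> 'a measure \<Rightarrow> ('a \<Rightarrow> real \<Rightarrow> real) \<Rightarrow> real \<Rightarrow> ennreal" where
  "muckenhoupt_const d M \<phi> p =
     (SUP t\<in>{0<..}. SUP x\<in>space M. SUP r\<in>{0<..}.
        (let B = qball d M x r in
         (\<integral>\<^sup>+y\<in>B. ennreal (\<phi> y t) \<partial>M) / emeasure M B *
         (if p = 1 then esssup (restrict_space M B) (\<lambda>y. inverse (ennreal (\<phi> y t)))
          else ennreal_powr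
            ((\<integral>\<^sup>+y\<in>B. ennreal_powr (inverse (ennreal (\<phi> y t))) (1 / (p - 1)) \<partial>M) / emeasure M B)
            (p - 1))))"

definition muckenhoupt ::
    "('a \<Rightarrow> 'a \<Rightarrow> real) \<Rightarrow> 'a measure \<Rightarrow> real \<Rightarrow> ('a \<Rightarrow> real \<Rightarrow> real) set" where
  "muckenhoupt d M p = {\<phi>. muckenhoupt_const d M \<phi> p < \<infinity>}"

definition muckenhoupt_inf ::
    "('a \<Rightarrow> 'a \<Rightarrow> real) \<Rightarrow> 'a measure \<Rightarrow> ('a \<Rightarrow> real \<Rightarrow> real) set" where
  "muckenhoupt_inf d M = (\<Union>p\<in>{1..}. muckenhoupt d M p)"

definition orlicz_function :: "(real \<Rightarrow> real) \<Rightarrow> bool" where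
  "orlicz_function \<Phi> \<longleftrightarrow>
     mono_on {0..} \<Phi> \<and> \<Phi> 0 = 0 \<and> (\<forall>t>0. 0 < \<Phi> t) \<and> filterlim \<Phi> at_top at_top"

definition growth_function ::
    "('a \<Rightarrow> 'a \<Rightarrow> real) \<Rightarrow> 'a measure \<Rightarrow> ('a \<Rightarrow> real \<Rightarrow> real) \<Rightarrow> bool" where
  "growth_function d M \<phi> \<longleftrightarrow>
     (\<forall>x\<in>space M. orlicz_function (\<phi> x)) \<and>
     (\<forall>t\<ge>0. (\<lambda>x. \<phi> x t) \<in> borel_measurable M) \<and>
     \<phi> \<in> muckenhoupt_inf d M \<and>
     unif_upper_type M \<phi> 1 \<and>
     (\<exists>p. 0 < p \<and> p \<le> 1 \<and> unif_lower_type M \<phi> p)"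

section \<open>The norms\<close>

text \<open>Both (quasi-)norms take values in \<open>[0,\<infinity>]\<close>; the infimum of the empty set is infinity.\<close>

definition musielak_orlicz_norm ::
    "'a measure \<Rightarrow> ('a \<Rightarrow> real \<Rightarrow> real) \<Rightarrow> ('a \<Rightarrow> 'b::real_normed_vector) \<Rightarrow> ennreal" where
  "musielak_orlicz_norm M \<phi> f =
     (INF \<rho>\<in>{\<rho>::real. 0 < \<rho> \<and> (\<integral>\<^sup>+x. ennreal (\<phi> x (norm (f x) / \<rho>)) \<partial>M) \<le> 1}. ennreal \<rho>)"

definition ball_norm ::
    "('a \<Rightarrow> 'a \<Rightarrow> real) \<Rightarrow> 'a measure \<Rightarrow> ('a \<Rightarrow> real \<Rightarrow> real) \<Rightarrow> 'a \<Rightarrow> real \<Rightarrow> ennreal" where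
  "ball_norm d M \<phi> x r = musielak_orlicz_norm M \<phi> (indicator (qball d M x r) :: 'a \<Rightarrow> real)"

definition average ::
    "'a measure \<Rightarrow> 'a set \<Rightarrow> ('a \<Rightarrow> 'b::{banach, second_countable_topology}) \<Rightarrow> 'b" where
  "average M B f = (1 / measure M B) *\<^sub>R (LINT y:B|M. f y)"

definition bmo_norm ::
    "('a \<Rightarrow> 'a \<Rightarrow> real) \<Rightarrow> 'a measure \<Rightarrow> ('a \<Rightarrow> real \<Rightarrow> real) \<Rightarrow>
     ('a \<Rightarrow> 'b::{banach, second_countable_topology}) \<Rightarrow> ennreal" where
  "bmo_norm d M \<phi> f =
     (SUP x\<in>space M. SUP r\<in>{0<..}.
        (let B = qball d M x r in
         (\<integral>\<^sup>+y\<in>B. ennreal (norm (f y - average M B f)) \<partial>M) / ball_norm d M \<phi> x r))"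

text \<open>Locally integrable means, as usual in this setting, integrable on every ball.\<close>

definition BMO ::
    "('a \<Rightarrow> 'a \<Rightarrow> real) \<Rightarrow> 'a measure \<Rightarrow> ('a \<Rightarrow> real \<Rightarrow> real) \<Rightarrow>
     ('a \<Rightarrow> 'b::{banach, second_countable_topology}) set" where
  "BMO d M \<phi> =
     {f. (\<forall>x\<in>space M. \<forall>r>0. set_integrable M (qball d M x r) f) \<and> bmo_norm d M \<phi> f < \<infinity>}"

end

theory Submission
  imports Defs
begin

text \<open>
  Bounding \<open>f\<^bsub>B\<^esub> - f\<^bsub>KB\<^esub>\<close> by \<open>\<parallel>\<chi>\<^bsub>KB\<^esub>\<parallel> / \<mu>(B)\<close> directly loses the factor \<open>K powr (- \<alpha>)\<close>, so the
  difference is instead telescoped along balls \<open>sB\<close> whose radii grow by factors of at most 2. One step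
  costs \<open>\<parallel>\<chi>\<^bsub>2sB\<^esub>\<parallel> / \<mu>(sB)\<close> times the BMO norm. The Muckenhoupt condition, doubling and the lower
  type bound the numerator by a multiple of \<open>s powr (n p\<^sub>1 / p) \<parallel>\<chi>\<^bsub>B\<^esub>\<parallel>\<close>, and reverse doubling bounds
  the denominator from below by a multiple of \<open>s powr \<alpha> \<mu>(B)\<close>, as long as \<open>sB\<close> is smaller than the
  space; beyond that the step vanishes. Doubling and reverse doubling force \<open>\<alpha> < n \<le> n p\<^sub>1 / p\<close>
  unless the space is a point, so the resulting series is geometric and dominated by its last term.
\<close>

section \<open>Muckenhoupt weights\<close>

lemma set_nn_integral_pos:
  assumes [measurable]: "g \<in> borel_measurable M" "A \<in> sets M"
    and "emeasure M A > 0" and "\<And>y. y \<in> A \<Longrightarrow> g y > 0"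
  shows "0 < (\<integral>\<^sup>+y\<in>A. (g y :: ennreal) \<partial>M)"
proof (rule ccontr)
  assume "\<not> ?thesis"
  then have "emeasure M {y \<in> space M. g y * indicator A y \<noteq> 0} = 0"
    by (subst (asm) not_gr_zero, subst (asm) nn_integral_0_iff) auto
  moreover have "{y \<in> space M. g y * indicator A y \<noteq> 0} = A"
    using assms(4) sets.sets_into_space[OF assms(2)] by (force simp: indicator_def)
  ultimately show False using assms(3) by simp
qed

text \<open>
  A crude form of Hoelder's inequality: \<open>1 \<le> c w + (c w) powr (- 1 / (p - 1))\<close> for every
  \<open>c > 0\<close>, and \<open>c\<close> is chosen such that \<open>c w\<close> has integral \<open>a / 2\<close> over \<open>A\<close>.
\<close>

lemma measure_powr_le_weight_dual:
  fixes w :: "'a \<Rightarrow> real"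
  assumes [measurable]: "w \<in> borel_measurable M" "A \<in> sets M"
    and pos: "\<And>y. y \<in> A \<Longrightarrow> 0 < w y" and p: "1 < p"
    and A: "emeasure M A = ennreal a" "0 < a"
    and W: "(\<integral>\<^sup>+y\<in>A. ennreal (w y) \<partial>M) = ennreal u" "0 < u"
    and S: "(\<integral>\<^sup>+y\<in>A. ennreal (w y powr (- 1 / (p - 1))) \<partial>M) \<le> ennreal s" "0 < s"
  shows "(a / 2) powr p \<le> u * s powr (p - 1)"
proof -
  define q where "q = 1 / (p - 1)"
  have q: "q > 0" "q * (p - 1) = 1" using p by (auto simp: q_def)
  define c where "c = a / (2 * u)"
  have c: "c > 0" using A W by (simp add: c_def)
  \<comment> \<open>Both terms are nonnegative, and either \<open>c * w y\<close> or its negative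
    power is at least 1.\<close>
  have one: "1 \<le> c * w y + c powr (-q) * w y powr (-q)" if "y \<in> A" for y
  proof -
    have cw: "0 < c * w y" using c pos[OF that] by simp
    show ?thesis
    proof (cases "c * w y \<ge> 1")
      case True then show ?thesis by (simp add: add_increasing2)
    next
      case False
      then have "(c * w y) powr (-q) \<ge> (c * w y) powr 0"
        using cw q by (intro powr_mono') auto
      then have "(c * w y) powr (-q) \<ge> 1" using cw c pos[OF that] by simp
      then show ?thesis using cw c pos[OF that] by (simp add: powr_mult add_increasing)
    qed
  qed
  have "ennreal a = (\<integral>\<^sup>+y\<in>A. 1 \<partial>M)" using A by simp
  also have "\<dots> \<le> (\<integral>\<^sup>+y. ennreal c * (ennreal (w y) * indicator A y)
      + ennreal (c powr (-q)) * (ennreal (w y powr (-q)) * indicator A y) \<partial>M)"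
  proof (rule nn_integral_mono)
    fix y
    show "1 * indicator A y \<le> ennreal c * (ennreal (w y) * indicator A y)
      + ennreal (c powr (-q)) * (ennreal (w y powr (-q)) * indicator A y)"
    proof (cases "y \<in> A")
      case True
      have "ennreal 1 \<le> ennreal (c * w y + c powr (-q) * w y powr (-q))"
        using one[OF True] by (rule ennreal_leI)
      then show ?thesis using True c pos[OF True] by (simp add: ennreal_mult')
    qed simp
  qed
  also have "\<dots> = ennreal c * (\<integral>\<^sup>+y\<in>A. ennreal (w y) \<partial>M)
      + ennreal (c powr (-q)) * (\<integral>\<^sup>+y\<in>A. ennreal (w y powr (-q)) \<partial>M)"
    by (subst nn_integral_add) (auto simp: nn_integral_cmult)
  also have "\<dots> \<le> ennreal c * ennreal u + ennreal (c powr (-q)) * ennreal s"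
    using W S by (intro add_mono mult_left_mono) (auto simp: q_def)
  also have "\<dots> = ennreal (c * u + c powr (-q) * s)"
    using c W S by (simp add: ennreal_mult')
  finally have "a \<le> c * u + c powr (-q) * s"
    using c W S by (subst (asm) ennreal_le_iff) (auto intro!: add_nonneg_nonneg)
  moreover have "c * u = a / 2" using W by (simp add: c_def)
  ultimately have "a / 2 \<le> c powr (-q) * s" by simp
  \<comment> \<open>The power \<open>p - 1\<close> turns \<open>c powr (-q)\<close> into
    \<open>1 / c = 2 * u / a\<close>, which brings in the weight of \<open>A\<close>; a further
    factor \<open>a / 2\<close> then completes the power \<open>p\<close> on the left.\<close>
  then have "(a / 2) powr (p - 1) \<le> (c powr (-q) * s) powr (p - 1)"
    using A p by (intro powr_mono2) auto
  also have "\<dots> = c powr - 1 * s powr (p - 1)"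
    using c S q by (simp add: powr_mult powr_powr)
  also have "c powr - 1 = 2 * u / a" using c A W by (simp add: powr_minus_divide c_def)
  finally have "(a / 2) * (a / 2) powr (p - 1) \<le> (a / 2) * (2 * u / a * s powr (p - 1))"
    using A by (intro mult_left_mono) auto
  also have "\<dots> = u * s powr (p - 1)" using A by simp
  also have "(a / 2) * (a / 2) powr (p - 1) = (a / 2) powr p"
    using A by (simp add: powr_diff)
  finally show ?thesis .
qed

text \<open>The quantity whose supremum is taken in \<^const>\<open>muckenhoupt_const\<close>.\<close>

definition muckenhoupt_term :: "'a measure \<Rightarrow> real \<Rightarrow> 'a set \<Rightarrow> ('a \<Rightarrow> real) \<Rightarrow> ennreal" where
  "muckenhoupt_term M p B w =
     (\<integral>\<^sup>+y\<in>B. ennreal (w y) \<partial>M) / emeasure M B *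
     (if p = 1 then esssup (restrict_space M B) (\<lambda>y. inverse (ennreal (w y)))
      else ennreal_powr
        ((\<integral>\<^sup>+y\<in>B. ennreal_powr (inverse (ennreal (w y))) (1 / (p - 1)) \<partial>M) / emeasure M B)
        (p - 1))"

text \<open>For \<open>p > 1\<close>, the dual integral \<open>s\<close> over \<open>B\<close>
  dominates the one over \<open>A\<close>. The crude Hoelder bound gives
  \<open>(a / 2) powr p \<le> v * s powr (p - 1)\<close>, the Muckenhoupt bound gives
  \<open>u * s powr (p - 1) \<le> Q * b powr p\<close>, and eliminating \<open>s\<close> compares
  the weights \<open>u\<close> of \<open>B\<close> and \<open>v\<close> of \<open>A\<close>. For
  \<open>p = 1\<close> the essential supremum of \<open>1 / w\<close> takes the place of the dual
  integral.\<close>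

lemma muckenhoupt_weight_comparison:
  fixes w :: "'a \<Rightarrow> real"
  assumes [measurable]: "w \<in> borel_measurable M" "A \<in> sets M" "B \<in> sets M"
    and AB: "A \<subseteq> B" and pos: "\<And>y. y \<in> B \<Longrightarrow> 0 < w y" and p: "1 \<le> p"
    and A: "emeasure M A = ennreal a" "0 < a" and B: "emeasure M B = ennreal b"
    and Q: "muckenhoupt_term M p B w \<le> ennreal Q" "0 \<le> Q"
  shows "(\<integral>\<^sup>+y\<in>B. ennreal (w y) \<partial>M) < \<infinity>" (is "?W < _")
    and "(\<integral>\<^sup>+y\<in>B. ennreal (w y) \<partial>M) \<le>
         ennreal (2 powr p * Q * (b / a) powr p) * (\<integral>\<^sup>+y\<in>A. ennreal (w y) \<partial>M)"
proof -
  let ?V = "\<integral>\<^sup>+y\<in>A. ennreal (w y) \<partial>M"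
  have ab: "a \<le> b"
  proof -
    have "ennreal a \<le> ennreal b" using emeasure_mono[OF AB, of M] A B by auto
    then show ?thesis using A by (auto simp: ennreal_le_iff2)
  qed
  then have b: "0 < b" using A by simp
  have Vpos: "0 < ?V" using A pos AB by (intro set_nn_integral_pos) auto
  have VW: "?V \<le> ?W"
    using AB by (intro nn_integral_mono) (auto simp: indicator_def)
  then have Wpos: "0 < ?W" using Vpos by simp
  have main: "?W < \<infinity> \<and> ?W \<le> ennreal (2 powr p * Q * (b / a) powr p) * ?V"
  proof (cases "p = 1")
    case True
    define S where "S = esssup (restrict_space M B) (\<lambda>y. inverse (ennreal (w y)))"
    have "AE y in restrict_space M B. inverse (ennreal (w y)) \<le> S"
      unfolding S_def by (rule esssup_AE)
    then have S: "AE y in M. y \<in> B \<longrightarrow> inverse (ennreal (w y)) \<le> S"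
      by (subst (asm) AE_restrict_space_iff) auto
    \<comment> \<open>If \<open>S\<close> were 0, then \<open>w\<close> would be infinite almost
      everywhere on \<open>B\<close>, a set of positive measure.\<close>
    have S0: "S > 0"
    proof (rule ccontr)
      assume "\<not> S > 0"
      with S have "AE y in M. y \<notin> B"
        by (elim AE_mp) (auto intro!: AE_I2 simp: ennreal_inverse_eq_0_iff)
      then have "emeasure M B = 0" using sets.sets_into_space[OF assms(3)]
        by (subst (asm) AE_iff_measurable[of B]) auto
      then show False using b B by simp
    qed
    have QS: "?W / ennreal b * S \<le> ennreal Q"
      using Q B by (simp add: muckenhoupt_term_def True S_def)
    \<comment> \<open>Zero times infinity is 0 in \<open>ennreal\<close>, so a finite product shows
      that a factor is finite only once the other factor is known to be positive.\<close>
    then have lt: "?W / ennreal b * S < \<infinity>" by (auto simp: less_top[symmetric] top_unique)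
    then have "?W / ennreal b \<noteq> \<infinity>" using S0 by (auto simp: ennreal_mult_less_top)
    then have W: "?W < \<infinity>" using b by (auto simp: ennreal_divide_eq_top_iff less_top[symmetric])
    have "?W / ennreal b > 0" using Wpos by (simp add: ennreal_zero_less_divide)
    with lt have Sfin: "S < \<infinity>" by (auto simp: ennreal_mult_less_top)
    obtain s where s: "S = ennreal s" "0 < s" using Sfin S0 by (cases S) auto
    obtain u where u: "?W = ennreal u" "0 < u" using W Wpos by (cases ?W) auto
    obtain v where v: "?V = ennreal v" "0 < v" using W VW Vpos by (cases ?V) auto
    have "ennreal a = (\<integral>\<^sup>+y\<in>A. 1 \<partial>M)" using A by simp
    also have "\<dots> \<le> (\<integral>\<^sup>+y. ennreal s * (ennreal (w y) * indicator A y) \<partial>M)"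
    proof (rule nn_integral_mono_AE)
      show "AE y in M. 1 * indicator A y \<le> ennreal s * (ennreal (w y) * indicator A y)"
        using S
      proof eventually_elim
        case (elim y)
        show ?case
        proof (cases "y \<in> A")
          case True
          then have wy: "0 < w y" "ennreal (inverse (w y)) \<le> ennreal s"
            using elim AB pos s by (auto simp: inverse_ennreal)
          then have "1 \<le> s * w y" using s(2) by (simp add: field_simps)
          then have "ennreal 1 \<le> ennreal (s * w y)" by (rule ennreal_leI)
          then show ?thesis using True s by (simp add: ennreal_mult')
        qed simp
      qed
    qed
    also have "\<dots> = ennreal (s * v)" using s v by (simp add: nn_integral_cmult ennreal_mult')
    finally have av: "a \<le> s * v" using s v by simp
    have "ennreal (u / b * s) \<le> ennreal Q"
      using QS u s b by (subst ennreal_mult) (auto simp: divide_ennreal)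
    then have us: "u * s \<le> Q * b" using Q b by (simp add: field_simps)
    have "u * a \<le> u * (s * v)" using av u by (intro mult_left_mono) auto
    also have "\<dots> \<le> Q * b * v" using mult_right_mono[OF us, of v] v by (simp add: ac_simps)
    \<comment> \<open>A factor 2 is given away so that both cases end with the constant
      \<open>2 powr p\<close>.\<close>
    also have "\<dots> \<le> 2 * (Q * b * v)" using Q b v by simp
    finally have "u \<le> 2 powr p * Q * (b / a) powr p * v"
      using True A b by (simp add: field_simps)
    then have "ennreal u \<le> ennreal (2 powr p * Q * (b / a) powr p) * ennreal v"
      using v Q by (subst ennreal_mult[symmetric]) auto
    then show ?thesis using W u v by simp
  next
    case False
    then have p1: "1 < p" using p by simp
    define q where "q = 1 / (p - 1)"
    let ?S = "\<integral>\<^sup>+y\<in>B. ennreal (w y powr (- 1 / (p - 1))) \<partial>M"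
    have S_eq: "(\<integral>\<^sup>+y\<in>B. ennreal_powr (inverse (ennreal (w y))) (1 / (p - 1)) \<partial>M) = ?S"
    proof (intro nn_integral_cong)
      fix y
      show "ennreal_powr (inverse (ennreal (w y))) (1 / (p - 1)) * indicator B y =
            ennreal (w y powr (- 1 / (p - 1))) * indicator B y"
        using pos[of y]
        by (cases "y \<in> B") (auto simp: ennreal_powr_def inverse_ennreal inverse_powr powr_minus)
    qed
    have Spos: "0 < ?S" using b B pos by (intro set_nn_integral_pos) (auto, metis less_irrefl)
    have QS: "?W / ennreal b * ennreal_powr (?S / ennreal b) (p - 1) \<le> ennreal Q"
      using Q False B by (simp add: muckenhoupt_term_def S_eq)
    then have lt: "?W / ennreal b * ennreal_powr (?S / ennreal b) (p - 1) < \<infinity>"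
      by (auto simp: less_top[symmetric] top_unique)
    have Wb: "0 < ?W / ennreal b" using Wpos by (simp add: ennreal_zero_less_divide)
    have "ennreal_powr (?S / ennreal b) (p - 1) < \<infinity>"
      using lt Wb by (auto simp: ennreal_mult_less_top)
    then have "?S / ennreal b \<noteq> \<infinity>" by (auto simp: ennreal_powr_def)
    then have "?S \<noteq> \<infinity>" using b by (auto simp: ennreal_divide_eq_top_iff)
    then obtain s where s: "?S = ennreal s" "0 < s" using Spos by (cases ?S) auto
    have powr_eq: "ennreal_powr (?S / ennreal b) (p - 1) = ennreal ((s / b) powr (p - 1))"
      using s b by (simp add: ennreal_powr_def divide_ennreal)
    have "?W / ennreal b \<noteq> \<infinity>"
      using lt powr_eq s b by (auto simp: ennreal_mult_less_top)
    then have W: "?W < \<infinity>" using b by (auto simp: ennreal_divide_eq_top_iff less_top[symmetric])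
    obtain u where u: "?W = ennreal u" "0 < u" using W Wpos by (cases ?W) auto
    obtain v where v: "?V = ennreal v" "0 < v" using W VW Vpos by (cases ?V) auto
    have "ennreal (u / b * (s / b) powr (p - 1)) \<le> ennreal Q"
      using QS powr_eq u b by (subst ennreal_mult) (auto simp: divide_ennreal)
    then have "u / b * (s / b) powr (p - 1) \<le> Q" using Q by simp
    moreover have "u / b * (s / b) powr (p - 1) = u * s powr (p - 1) / b powr p"
      using s b by (simp add: powr_divide powr_diff)
    ultimately have "u * s powr (p - 1) / b powr p \<le> Q" by metis
    then have us: "u * s powr (p - 1) \<le> Q * b powr p" using b by (simp add: divide_le_eq)
    have "(a / 2) powr p \<le> v * s powr (p - 1)"
    proof (rule measure_powr_le_weight_dual)
      show "(\<integral>\<^sup>+y\<in>A. ennreal (w y powr (- 1 / (p - 1))) \<partial>M) \<le> ennreal s"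
        unfolding s(1)[symmetric] using AB by (intro nn_integral_mono) (auto simp: indicator_def)
    qed (use A v s p1 pos AB in auto)
    then have "u * (a / 2) powr p \<le> u * (v * s powr (p - 1))"
      using u by (intro mult_left_mono) auto
    also have "\<dots> \<le> Q * b powr p * v"
      using mult_right_mono[OF us, of v] v by (simp add: ac_simps)
    finally have "u \<le> 2 powr p * Q * (b / a) powr p * v"
      using A b by (simp add: powr_divide field_simps)
    then have "ennreal u \<le> ennreal (2 powr p * Q * (b / a) powr p) * ennreal v"
      using v Q by (subst ennreal_mult[symmetric]) auto
    then show ?thesis using W u v by simp
  qed
  then show "?W < \<infinity>" and "?W \<le> ennreal (2 powr p * Q * (b / a) powr p) * ?V"
    by blast+
qed

section \<open>Balls and the exponents of doubling and reverse doubling\<close>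

lemma qball_mono: "r \<le> s \<Longrightarrow> qball d M x r \<subseteq> qball d M x s"
  by (auto simp: qball_def)

lemma space_of_homogeneous_type_qball:
  assumes "space_of_homogeneous_type d M" "x \<in> space M" "0 < r"
  shows "qball d M x r \<in> sets M" "emeasure M (qball d M x r) = ennreal (measure M (qball d M x r))"
    "0 < measure M (qball d M x r)"
proof -
  let ?B = "qball d M x r"
  have B: "?B \<in> sets M" "0 < emeasure M ?B"
    using assms unfolding space_of_homogeneous_type_def by blast+
  obtain C where C: "C \<ge> 1" "ennreal C * emeasure M ?B < \<infinity>"
    using assms unfolding space_of_homogeneous_type_def by blast
  then have fin: "emeasure M ?B < \<infinity>" by (auto simp: ennreal_mult_less_top)
  show "?B \<in> sets M" by fact
  show e: "emeasure M ?B = ennreal (measure M ?B)"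
    using fin by (intro emeasure_eq_ennreal_measure) auto
  show "0 < measure M ?B" using B e by (metis ennreal_eq_0_iff less_irrefl not_le)
qed

lemma dist_le_qdiam:
  assumes "x \<in> space M" "y \<in> space M"
  shows "ereal (d x y) \<le> qdiam d M"
  unfolding qdiam_def using assms by (meson SUP_upper order_trans)

text \<open>Balls are defined by a strict inequality while the diameter may be attained, hence the
  strict hypothesis. Beyond the diameter, averages over concentric balls no longer change.\<close>

lemma qball_eq_space:
  assumes "x \<in> space M" "qdiam d M < ereal r"
  shows "qball d M x r = space M"
proof -
  have "d y x < r" if "y \<in> space M" for y
    using dist_le_qdiam[OF that assms(1), of d] assms(2)
    by (metis ereal_less(2) le_less_trans ereal_less_eq(3) less_ereal.simps(1))
  then show ?thesis by (auto simp: qball_def)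
qed

text \<open>Reverse doubling is applied under a condition on the final radius only. As
  \<open>s \<ge> 1\<close>, this yields both side conditions in \<open>cond_R\<close>, also for
  infinite diameter.\<close>

lemma ereal_reverse_doubling_range:
  fixes D :: ereal
  assumes "0 < r" "1 \<le> s" "ereal (s * r) < 2 * D"
  shows "ereal r < 2 * D" "ereal s < 2 * D / ereal r"
proof -
  have "r \<le> s * r" using assms by simp
  then show "ereal r < 2 * D" using assms(3) by (meson ereal_less_eq(3) le_less_trans)
  show "ereal s < 2 * D / ereal r"
    using assms by (simp add: ereal_less_divide_pos mult.commute)
qed

text \<open>The definition of \<open>cond_R\<close> compares \<alpha> with some doubling exponent
  only; here every doubling exponent is reached. The measures of two concentric balls with radius
  ratio \<open>s\<close> have a ratio of at least a multiple of \<open>s powr \<alpha>\<close> and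
  at most a multiple of \<open>s powr n\<close>, and \<open>s\<close> can be arbitrarily
  large.\<close>

lemma cond_R_le_cond_D:
  assumes hom: "space_of_homogeneous_type d M" and x: "x \<in> space M"
    and R: "cond_R d M \<alpha>" and D: "cond_D d M n" and diam: "0 < qdiam d M"
  shows "\<alpha> \<le> n"
proof (rule ccontr)
  assume "\<not> \<alpha> \<le> n"
  then have an: "0 < \<alpha> - n" by simp
  obtain C where C: "C \<ge> 1" "\<And>r s. r > 0 \<Longrightarrow> s \<ge> 1 \<Longrightarrow> ereal r < 2 * qdiam d M \<Longrightarrow>
      ereal s < 2 * qdiam d M / ereal r \<Longrightarrow>
      inverse C * s powr \<alpha> * measure M (qball d M x r) \<le> measure M (qball d M x (s * r))"
    using R x unfolding cond_R_def by blast
  obtain C' where C': "\<And>r s. r > 0 \<Longrightarrow> s \<ge> 1 \<Longrightarrow>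
      measure M (qball d M x (s * r)) \<le> C' * s powr n * measure M (qball d M x r)"
    using D x unfolding cond_D_def by blast
  obtain \<delta> where \<delta>: "0 < \<delta>" "ereal \<delta> < 2 * qdiam d M"
    using diam ereal_dense2[of 0 "2 * qdiam d M"] by (auto simp: ereal_zero_less_0_iff)
  have bound: "s powr (\<alpha> - n) \<le> C * C'" if s: "s \<ge> 1" for s
  proof -
    \<comment> \<open>The larger radius is kept fixed at \<delta> and the smaller one shrinks, so no
      \<open>s\<close> leaves the range of reverse doubling, even in a bounded space.\<close>
    define r where "r = \<delta> / s"
    have r: "0 < r" "s * r = \<delta>" using \<delta> s by (auto simp: r_def)
    let ?m = "measure M (qball d M x r)"
    have m: "?m > 0" using space_of_homogeneous_type_qball(3)[OF hom x r(1)] .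
    have "inverse C * s powr \<alpha> * ?m \<le> C' * s powr n * ?m"
      using C(2)[OF r(1) s] C'[OF r(1) s] ereal_reverse_doubling_range[OF r(1) s] \<delta> r(2)
      by (metis order_trans)
    then have "inverse C * s powr \<alpha> \<le> C' * s powr n" using m by simp
    then show ?thesis using C(1) s by (simp add: powr_diff field_simps)
  qed
  \<comment> \<open>This makes \<open>C * C' + 1\<close> a base above 1, so that its root
    \<open>s\<close> is an admissible factor; \<open>s\<close> is chosen to exceed the bound by
    exactly 1.\<close>
  have "1 \<le> C * C'" using bound[of 1] by simp
  define s where "s = (C * C' + 1) powr (1 / (\<alpha> - n))"
  have "s \<ge> 1" unfolding s_def using \<open>1 \<le> C * C'\<close> an by (intro ge_one_powr_ge_zero) auto
  moreover have "s powr (\<alpha> - n) = C * C' + 1"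
    using an \<open>1 \<le> C * C'\<close> by (simp add: s_def powr_powr)
  ultimately show False using bound[of s] by simp
qed

lemma cond_D_mono:
  assumes "cond_D d M n" "n \<le> n'"
  shows "cond_D d M n'"
proof -
  obtain C where C: "\<forall>x\<in>space M. \<forall>r>0. \<forall>s\<ge>1.
      measure M (qball d M x (s * r)) \<le> C * s powr n * measure M (qball d M x r)"
    using assms unfolding cond_D_def by blast
  \<comment> \<open>The constant in \<open>cond_D\<close> has no prescribed sign, so its absolute
    value is taken before the power is enlarged.\<close>
  have "measure M (qball d M x (s * r)) \<le> \<bar>C\<bar> * s powr n' * measure M (qball d M x r)"
    if "x \<in> space M" "r > 0" "s \<ge> 1" for x r s
  proof -
    have "C * s powr n \<le> \<bar>C\<bar> * s powr n'"
      using that assms by (intro mult_mono powr_mono) auto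
    then have "C * s powr n * measure M (qball d M x r) \<le> \<bar>C\<bar> * s powr n' * measure M (qball d M x r)"
      by (intro mult_right_mono) auto
    then show ?thesis using C that by (meson order_trans)
  qed
  then show ?thesis using assms unfolding cond_D_def by force
qed

lemma cond_R_antimono:
  assumes "cond_R d M \<alpha>" "0 \<le> \<alpha>'" "\<alpha>' \<le> \<alpha>"
  shows "cond_R d M \<alpha>'"
proof -
  obtain C where C: "C \<ge> 1" "\<forall>x\<in>space M. \<forall>r>0. \<forall>s\<ge>1.
      ereal r < 2 * qdiam d M \<and> ereal s < 2 * qdiam d M / ereal r \<longrightarrow>
      inverse C * s powr \<alpha> * measure M (qball d M x r) \<le> measure M (qball d M x (s * r))"
    using assms unfolding cond_R_def by blast
  have "inverse C * s powr \<alpha>' * measure M (qball d M x r) \<le> inverse C * s powr \<alpha> * measure M (qball d M x r)"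
    if "s \<ge> 1" for x r s
    using C that assms by (intro mult_right_mono mult_left_mono powr_mono) auto
  then show ?thesis
    using C assms unfolding cond_R_def by (meson order_trans)
qed

text \<open>Exponent 0 amounts to monotonicity of the measure. This makes the set of reverse
  doubling exponents nonempty and its supremum nonnegative.\<close>

lemma cond_R_0:
  assumes hom: "space_of_homogeneous_type d M" and D: "cond_D d M n"
  shows "cond_R d M 0"
proof -
  have "measure M (qball d M x r) \<le> measure M (qball d M x (s * r))"
    if "x \<in> space M" "r > 0" "s \<ge> 1" for x r s
  proof -
    have sr: "r \<le> s * r" "0 < s * r" using that by auto
    show ?thesis
      using space_of_homogeneous_type_qball(1,2)[OF hom that(1) sr(2)] that
        space_of_homogeneous_type_qball(1)[OF hom that(1,2)] qball_mono[OF sr(1), of d M x]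
      by (intro measure_mono_fmeasurable) (auto simp: fmeasurable_def)
  qed
  then have "\<exists>C\<ge>1. \<forall>x\<in>space M. \<forall>r>0. \<forall>s\<ge>1.
      ereal r < 2 * qdiam d M \<and> ereal s < 2 * qdiam d M / ereal r \<longrightarrow>
      inverse C * s powr 0 * measure M (qball d M x r) \<le> measure M (qball d M x (s * r))"
    by (intro exI[of _ 1]) auto
  moreover have "0 \<le> n" using D by (simp add: cond_D_def)
  ultimately show ?thesis
    using D unfolding cond_R_def by blast
qed

section \<open>Telescoping over dyadic radii\<close>

text \<open>Factors of 2 are peeled off from the top, from \<open>K\<close> to \<open>K / 2\<close>,
  until a factor in (1, 2] is left, which is why steps by any such factor are assumed. As \<beta> is
  positive, the costs grow geometrically and the last one dominates.\<close>

lemma norm_diff_le_of_dyadic_steps: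
  fixes F :: "real \<Rightarrow> 'b::real_normed_vector"
  assumes step: "\<And>s l. 1 \<le> s \<Longrightarrow> 1 < l \<Longrightarrow> l \<le> 2 \<Longrightarrow> norm (F s - F (s * l)) \<le> c * s powr \<beta>"
    and \<beta>: "0 < \<beta>" and c: "0 \<le> c" and K: "1 < K"
  shows "norm (F 1 - F K) \<le> c / (1 - 2 powr (- \<beta>)) * K powr \<beta>"
proof -
  define e where "e = (2 :: real) powr (- \<beta>)"
  have e: "0 < e" "e < 1" using \<beta> by (auto simp: e_def powr_less_one)
  \<comment> \<open>The induction requires \<open>c \<le> C\<close> for a single step and
    \<open>(C + c) * e \<le> C\<close> for halving; this value satisfies both.\<close>
  define C where "C = c / (1 - e)"
  have cC: "c \<le> C" and C: "(C + c) * e \<le> C"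
  proof -
    show "c \<le> C" using e c by (simp add: C_def field_simps)
    have "C * (1 - e) = c" using e by (simp add: C_def)
    then have "C - C * e = c" by (simp add: algebra_simps)
    moreover have "c * e \<le> c" using c e by (simp add: mult_left_le)
    ultimately show "(C + c) * e \<le> C" by (simp add: algebra_simps)
  qed
  have *: "norm (F 1 - F K) \<le> C * K powr \<beta>" if "1 < K" "K \<le> 2 ^ m" for m K
    using that
  proof (induction m arbitrary: K)
    case (Suc m)
    show ?case
    proof (cases "K \<le> 2")
      case True
      have "norm (F 1 - F K) \<le> c * 1" using step[of 1 K] Suc.prems True by simp
      also have "\<dots> \<le> C * K powr \<beta>"
        using cC c \<beta> Suc.prems by (intro mult_mono ge_one_powr_ge_zero) auto
      finally show ?thesis .
    next
      case False
      have "norm (F 1 - F (K / 2)) \<le> C * (K / 2) powr \<beta>"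
        using Suc.IH[of "K / 2"] Suc.prems False by simp
      moreover have "norm (F (K / 2) - F K) \<le> c * (K / 2) powr \<beta>"
        using step[of "K / 2" 2] False by simp
      ultimately have "norm (F 1 - F K) \<le> (C + c) * (K / 2) powr \<beta>"
        using norm_triangle_ineq[of "F 1 - F (K / 2)" "F (K / 2) - F K"]
        by (simp add: distrib_right)
      also have "\<dots> = (C + c) * e * K powr \<beta>"
        using False by (simp add: e_def powr_divide powr_minus_divide)
      also have "\<dots> \<le> C * K powr \<beta>" using C by (intro mult_right_mono) auto
      finally show ?thesis .
    qed
  qed simp
  obtain m where "K < 2 ^ m" using real_arch_pow[of 2 K] by auto
  then show ?thesis using *[of K m] K by (simp add: C_def e_def)
qed

section \<open>Norms of characteristic functions of balls\<close>

lemma muckenhoupt_term_bound: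
  assumes "\<phi> \<in> muckenhoupt d M p"
  obtains Q where "0 \<le> Q" "\<And>t x r. 0 < t \<Longrightarrow> x \<in> space M \<Longrightarrow> 0 < r \<Longrightarrow>
    muckenhoupt_term M p (qball d M x r) (\<lambda>y. \<phi> y t) \<le> ennreal Q"
proof -
  obtain Q where Q: "muckenhoupt_const d M \<phi> p = ennreal Q" "0 \<le> Q"
    using assms by (cases "muckenhoupt_const d M \<phi> p") (auto simp: muckenhoupt_def)
  have "muckenhoupt_term M p (qball d M x r) (\<lambda>y. \<phi> y t) \<le> ennreal Q"
    if "0 < t" "x \<in> space M" "0 < r" for t x r
    unfolding Q(1)[symmetric] muckenhoupt_const_def muckenhoupt_term_def Let_def
    using that by (intro SUP_upper2[of t] SUP_upper2[of x] SUP_upper2[of r]) auto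
  with Q(2) show ?thesis by (rule that)
qed

lemma growth_functionD:
  assumes "growth_function d M \<phi>"
  shows "y \<in> space M \<Longrightarrow> \<phi> y 0 = 0" "y \<in> space M \<Longrightarrow> 0 < t \<Longrightarrow> 0 < \<phi> y t"
    "0 \<le> t \<Longrightarrow> (\<lambda>y. \<phi> y t) \<in> borel_measurable M"
  using assms by (auto simp: growth_function_def orlicz_function_def)

text \<open>Off the ball the integrand is \<open>\<phi> y 0\<close>, which vanishes, so the modular
  localizes to the ball.\<close>

lemma ball_norm_eq:
  assumes "\<And>y. y \<in> space M \<Longrightarrow> \<phi> y 0 = 0"
  shows "ball_norm d M \<phi> x r =
    (INF \<rho>\<in>{\<rho>. 0 < \<rho> \<and> (\<integral>\<^sup>+y\<in>qball d M x r. ennreal (\<phi> y (1 / \<rho>)) \<partial>M) \<le> 1}. ennreal \<rho>)"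
proof -
  have "(\<integral>\<^sup>+y. ennreal (\<phi> y (norm (indicator (qball d M x r) y :: real) / \<rho>)) \<partial>M) =
        (\<integral>\<^sup>+y\<in>qball d M x r. ennreal (\<phi> y (1 / \<rho>)) \<partial>M)" for \<rho>
    using assms by (intro nn_integral_cong) (auto simp: indicator_def)
  then show ?thesis by (simp add: ball_norm_def musielak_orlicz_norm_def)
qed

text \<open>By the lower type, enlarging \<rho> by a factor \<open>k > 1\<close> shrinks the modular
  by \<open>C * (1 / k) powr p\<close>. The root \<open>k = (C * T) powr (1 / p)\<close> brings a
  modular of at most \<open>T\<close> down to 1, and \<open>T > 1\<close> ensures that
  \<open>1 / k\<close> lies in the range of the lower type.\<close>

lemma ball_norm_le:
  assumes zero: "\<And>y. y \<in> space M \<Longrightarrow> \<phi> y 0 = 0"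
    and pos: "\<And>y t. y \<in> space M \<Longrightarrow> 0 < t \<Longrightarrow> 0 < \<phi> y t"
    and meas: "\<And>t. 0 \<le> t \<Longrightarrow> (\<lambda>y. \<phi> y t) \<in> borel_measurable M"
    and B: "qball d M x r \<in> sets M"
    and low: "\<And>y t s. y \<in> space M \<Longrightarrow> 0 \<le> t \<Longrightarrow> 0 < s \<Longrightarrow> s < 1 \<Longrightarrow>
      \<phi> y (s * t) \<le> C * s powr p * \<phi> y t"
    and C: "1 \<le> C" and p: "0 < p" and \<rho>: "0 < \<rho>" and T: "1 < T"
    and int: "(\<integral>\<^sup>+y\<in>qball d M x r. ennreal (\<phi> y (1 / \<rho>)) \<partial>M) \<le> ennreal T"
  shows "ball_norm d M \<phi> x r \<le> ennreal ((C * T) powr (1 / p) * \<rho>)"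
proof -
  let ?B = "qball d M x r"
  have "T \<le> C * T" using C T by simp
  with T have CT: "1 < C * T" by linarith
  define k where "k = (C * T) powr (1 / p)"
  have k: "1 < k" using CT p by (simp add: k_def)
  have kp: "(1 / k) powr p = 1 / (C * T)"
    using CT p by (simp add: k_def powr_divide powr_powr)
  have "(\<integral>\<^sup>+y\<in>?B. ennreal (\<phi> y (1 / (k * \<rho>))) \<partial>M)
      \<le> (\<integral>\<^sup>+y. ennreal (1 / T) * (ennreal (\<phi> y (1 / \<rho>)) * indicator ?B y) \<partial>M)"
  proof (rule nn_integral_mono)
    fix y assume y: "y \<in> space M"
    have "\<phi> y (1 / k * (1 / \<rho>)) \<le> C * (1 / k) powr p * \<phi> y (1 / \<rho>)"
      using k \<rho> y by (intro low) auto
    also have "\<dots> = 1 / T * \<phi> y (1 / \<rho>)" using C T by (simp add: kp)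
    finally have "ennreal (\<phi> y (1 / (k * \<rho>))) \<le> ennreal (1 / T * \<phi> y (1 / \<rho>))"
      by (intro ennreal_leI) simp
    also have "\<dots> = ennreal (1 / T) * ennreal (\<phi> y (1 / \<rho>))"
      using T by (intro ennreal_mult') simp
    finally show "ennreal (\<phi> y (1 / (k * \<rho>))) * indicator ?B y
        \<le> ennreal (1 / T) * (ennreal (\<phi> y (1 / \<rho>)) * indicator ?B y)"
      by (simp add: mult_right_mono mult.assoc[symmetric])
  qed
  also have "\<dots> = ennreal (1 / T) * (\<integral>\<^sup>+y\<in>?B. ennreal (\<phi> y (1 / \<rho>)) \<partial>M)"
    using B meas[of "1 / \<rho>"] \<rho> by (intro nn_integral_cmult) auto
  also have "\<dots> \<le> ennreal (1 / T) * ennreal T" using int by (intro mult_left_mono) auto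
  also have "\<dots> = 1" using T by (simp add: ennreal_mult'[symmetric])
  finally have "k * \<rho> \<in> {\<rho>. 0 < \<rho> \<and> (\<integral>\<^sup>+y\<in>?B. ennreal (\<phi> y (1 / \<rho>)) \<partial>M) \<le> 1}"
    using k \<rho> by simp
  then have "(INF \<rho>\<in>{\<rho>. 0 < \<rho> \<and> (\<integral>\<^sup>+y\<in>?B. ennreal (\<phi> y (1 / \<rho>)) \<partial>M) \<le> 1}. ennreal \<rho>)
      \<le> ennreal (k * \<rho>)"
    by (rule INF_lower)
  then show ?thesis using zero by (simp add: ball_norm_eq k_def)
qed

lemma unif_lower_typeE:
  assumes "unif_lower_type M \<phi> p" and "\<And>y t. y \<in> space M \<Longrightarrow> 0 \<le> t \<Longrightarrow> 0 \<le> \<phi> y t"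
  obtains C where "1 \<le> C" "\<And>y t s. y \<in> space M \<Longrightarrow> 0 \<le> t \<Longrightarrow> 0 < s \<Longrightarrow> s < 1 \<Longrightarrow>
      \<phi> y (s * t) \<le> C * s powr p * \<phi> y t"
proof -
  obtain C where C: "\<forall>x\<in>space M. \<forall>t\<ge>0. \<forall>s\<in>{0<..<1}. \<phi> x (s * t) \<le> C * s powr p * \<phi> x t"
    using assms(1) unfolding unif_lower_type_def ..
  have "\<phi> y (s * t) \<le> max 1 C * s powr p * \<phi> y t"
    if "y \<in> space M" "0 \<le> t" "0 < s" "s < 1" for y t s
  proof -
    have "C * s powr p * \<phi> y t \<le> max 1 C * s powr p * \<phi> y t"
      using that assms(2) by (intro mult_right_mono) auto
    moreover have "\<phi> y (s * t) \<le> C * s powr p * \<phi> y t" using C that by simp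
    ultimately show ?thesis by (rule order_trans[rotated])
  qed
  then show ?thesis using that[of "max 1 C"] by simp
qed

text \<open>If \<rho> is admissible for the ball, then by weight comparison and doubling the modular
  of the enlarged ball at the same \<rho> is at most a multiple of
  \<open>s powr (n * p\<^sub>1)\<close>. Repairing this by the lower type takes a root of order
  \<open>p\<close>, whence the exponent.\<close>

lemma ball_norm_doubling:
  assumes hom: "space_of_homogeneous_type d M" and D: "cond_D d M n"
    and growth: "growth_function d M \<phi>"
    and p1: "1 \<le> p\<^sub>1" "\<phi> \<in> muckenhoupt d M p\<^sub>1"
    and p: "0 < p" "unif_lower_type M \<phi> p"
  obtains c where "0 < c" "\<And>x r. x \<in> space M \<Longrightarrow> 0 < r \<Longrightarrow> ball_norm d M \<phi> x r < \<infinity>"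
    "\<And>x r s. x \<in> space M \<Longrightarrow> 0 < r \<Longrightarrow> 1 \<le> s \<Longrightarrow>
      ball_norm d M \<phi> x (s * r) \<le> ennreal (c * s powr (n * p\<^sub>1 / p)) * ball_norm d M \<phi> x r"
proof -
  note \<phi> = growth_functionD[OF growth]
  have nonneg: "0 \<le> \<phi> y t" if "y \<in> space M" "0 \<le> t" for y t
    using \<phi>(1,2)[of y] that by (cases "t = 0") (auto intro: less_imp_le)
  obtain C where C: "1 \<le> C" "\<And>y t s. y \<in> space M \<Longrightarrow> 0 \<le> t \<Longrightarrow> 0 < s \<Longrightarrow> s < 1 \<Longrightarrow>
      \<phi> y (s * t) \<le> C * s powr p * \<phi> y t"
    using unif_lower_typeE[OF p(2) nonneg] by metis
  note norm_le = ball_norm_le[of M \<phi>, OF \<phi> _ C(2,1) p(1)]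
  obtain Q where Q: "0 \<le> Q" "\<And>t x r. 0 < t \<Longrightarrow> x \<in> space M \<Longrightarrow> 0 < r \<Longrightarrow>
      muckenhoupt_term M p\<^sub>1 (qball d M x r) (\<lambda>y. \<phi> y t) \<le> ennreal Q"
    using muckenhoupt_term_bound[OF p1(2)] by metis
  have n: "0 < n" using D by (simp add: cond_D_def)
  obtain C\<^sub>D where CD: "\<And>x r s. x \<in> space M \<Longrightarrow> 0 < r \<Longrightarrow> 1 \<le> s \<Longrightarrow>
      measure M (qball d M x (s * r)) \<le> C\<^sub>D * s powr n * measure M (qball d M x r)"
    using D unfolding cond_D_def by blast
  note ball = space_of_homogeneous_type_qball[OF hom]
  have in_space: "y \<in> space M" if "y \<in> qball d M x r" for x y r
    using that by (simp add: qball_def)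
  \<comment> \<open>The summand 2 only serves to make \<open>T\<^sub>0\<close> exceed 1, as
    \<open>ball_norm_le\<close> demands.\<close>
  define T\<^sub>0 where "T\<^sub>0 = 2 powr p\<^sub>1 * Q * \<bar>C\<^sub>D\<bar> powr p\<^sub>1 + 2"
  have "0 \<le> 2 powr p\<^sub>1 * Q * \<bar>C\<^sub>D\<bar> powr p\<^sub>1" using Q(1) by simp
  then have T0: "1 < T\<^sub>0" by (simp add: T\<^sub>0_def)
  define c where "c = (C * T\<^sub>0) powr (1 / p)"
  have c: "0 < c" using C T0 by (simp add: c_def)
  \<comment> \<open>The bound is uniform in \<open>t\<close>; this matters because
    \<open>t = 1 / \<rho>\<close> varies over the infimum defining the norm.\<close>
  have comparison:
    "(\<integral>\<^sup>+y\<in>qball d M x (s * r). ennreal (\<phi> y t) \<partial>M) < \<infinity>"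
    "(\<integral>\<^sup>+y\<in>qball d M x (s * r). ennreal (\<phi> y t) \<partial>M)
      \<le> ennreal (T\<^sub>0 * s powr (n * p\<^sub>1)) * (\<integral>\<^sup>+y\<in>qball d M x r. ennreal (\<phi> y t) \<partial>M)"
    if x: "x \<in> space M" and r: "0 < r" and s: "1 \<le> s" and t: "0 < t" for x r s t
  proof -
    have sr: "r \<le> s * r" "0 < s * r" using r s by auto
    let ?a = "measure M (qball d M x r)" and ?b = "measure M (qball d M x (s * r))"
    have a: "0 < ?a" using ball(3)[OF x r] .
    note cmp = muckenhoupt_weight_comparison[OF \<phi>(3) ball(1)[OF x r] ball(1)[OF x sr(2)]
        qball_mono[OF sr(1)] \<phi>(2)[OF in_space t] p1(1) ball(2)[OF x r] a ball(2)[OF x sr(2)]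
        Q(2)[OF t x sr(2)] Q(1)]
    show "(\<integral>\<^sup>+y\<in>qball d M x (s * r). ennreal (\<phi> y t) \<partial>M) < \<infinity>"
      using t by (intro cmp) auto
    have "?b \<le> \<bar>C\<^sub>D\<bar> * s powr n * ?a"
      using CD[OF x r s] by (rule order_trans) (intro mult_right_mono, auto)
    then have "?b / ?a \<le> \<bar>C\<^sub>D\<bar> * s powr n" using a by (simp add: divide_le_eq)
    then have "(?b / ?a) powr p\<^sub>1 \<le> (\<bar>C\<^sub>D\<bar> * s powr n) powr p\<^sub>1"
      using p1 by (intro powr_mono2) auto
    also have "\<dots> = \<bar>C\<^sub>D\<bar> powr p\<^sub>1 * s powr (n * p\<^sub>1)"
      using s by (simp add: powr_mult powr_powr)
    finally have "2 powr p\<^sub>1 * Q * (?b / ?a) powr p\<^sub>1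
        \<le> 2 powr p\<^sub>1 * Q * (\<bar>C\<^sub>D\<bar> powr p\<^sub>1 * s powr (n * p\<^sub>1))"
      using Q by (intro mult_left_mono) auto
    also have "\<dots> \<le> T\<^sub>0 * s powr (n * p\<^sub>1)"
      by (simp add: T\<^sub>0_def distrib_right)
    finally have "ennreal (2 powr p\<^sub>1 * Q * (?b / ?a) powr p\<^sub>1) \<le> ennreal (T\<^sub>0 * s powr (n * p\<^sub>1))"
      by (rule ennreal_leI)
    then show "(\<integral>\<^sup>+y\<in>qball d M x (s * r). ennreal (\<phi> y t) \<partial>M)
      \<le> ennreal (T\<^sub>0 * s powr (n * p\<^sub>1)) * (\<integral>\<^sup>+y\<in>qball d M x r. ennreal (\<phi> y t) \<partial>M)"
      using t by (intro order_trans[OF cmp(2)] mult_right_mono) auto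
  qed
  show ?thesis
  proof (rule that[OF c])
    fix x r assume x: "x \<in> space M" and r: "(0::real) < r"
    \<comment> \<open>The comparison with \<open>s = 1\<close> is used for its finiteness claim
      alone; any finite modular gives a finite norm.\<close>
    obtain T where T: "(\<integral>\<^sup>+y\<in>qball d M x r. ennreal (\<phi> y 1) \<partial>M) = ennreal T" "0 \<le> T"
      using comparison(1)[OF x r, of 1 1]
      by (cases "\<integral>\<^sup>+y\<in>qball d M x r. ennreal (\<phi> y 1) \<partial>M") auto
    have "ball_norm d M \<phi> x r \<le> ennreal ((C * (T + 2)) powr (1 / p) * 1)"
      using T ball(1)[OF x r] by (intro norm_le) auto
    then show "ball_norm d M \<phi> x r < \<infinity>"
      by (metis ennreal_less_top infinity_ennreal_def le_less_trans)
  next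
    fix x r s assume x: "x \<in> space M" and r: "(0::real) < r" and s: "(1::real) \<le> s"
    have sr: "0 < s * r" using r s by simp
    define k where "k = c * s powr (n * p\<^sub>1 / p)"
    have k: "0 < k" using c s by (simp add: k_def)
    have norm_eq: "ball_norm d M \<phi> x r =
        (INF \<rho>\<in>{\<rho>. 0 < \<rho> \<and> (\<integral>\<^sup>+y\<in>qball d M x r. ennreal (\<phi> y (1 / \<rho>)) \<partial>M) \<le> 1}. ennreal \<rho>)"
      using \<phi>(1) by (rule ball_norm_eq)
    \<comment> \<open>With \<open>k\<close> moved to the left, the right side is a bare infimum, and
      a bound by each admissible \<rho> suffices.\<close>
    have "ball_norm d M \<phi> x (s * r) / ennreal k \<le> ball_norm d M \<phi> x r"
      unfolding norm_eq
    proof (rule INF_greatest, clarify)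
      fix \<rho> :: real
      assume \<rho>: "0 < \<rho>" and int: "(\<integral>\<^sup>+y\<in>qball d M x r. ennreal (\<phi> y (1 / \<rho>)) \<partial>M) \<le> 1"
      have s1: "1 \<le> s powr (n * p\<^sub>1)" using s n p1 by (intro ge_one_powr_ge_zero) auto
      have "(\<integral>\<^sup>+y\<in>qball d M x (s * r). ennreal (\<phi> y (1 / \<rho>)) \<partial>M)
          \<le> ennreal (T\<^sub>0 * s powr (n * p\<^sub>1)) * (\<integral>\<^sup>+y\<in>qball d M x r. ennreal (\<phi> y (1 / \<rho>)) \<partial>M)"
        using \<rho> by (intro comparison(2)[OF x r s]) auto
      also have "\<dots> \<le> ennreal (T\<^sub>0 * s powr (n * p\<^sub>1)) * 1"
        using int by (intro mult_left_mono) auto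
      finally have "ball_norm d M \<phi> x (s * r)
          \<le> ennreal ((C * (T\<^sub>0 * s powr (n * p\<^sub>1))) powr (1 / p) * \<rho>)"
        using \<rho> T0 s1 ball(1)[OF x sr]
        by (intro norm_le) (auto intro: less_le_trans simp: less_1_mult')
      also have "(C * (T\<^sub>0 * s powr (n * p\<^sub>1))) powr (1 / p) = k"
        using C T0 s by (simp add: k_def c_def powr_mult powr_powr)
      finally have "ball_norm d M \<phi> x (s * r) \<le> ennreal k * ennreal \<rho>"
        using k \<rho> by (simp add: ennreal_mult)
      then show "ball_norm d M \<phi> x (s * r) / ennreal k \<le> ennreal \<rho>"
        using k by (intro divide_le_posI_ennreal) auto
    qed
    then have "ennreal k * (ball_norm d M \<phi> x (s * r) / ennreal k) \<le> ennreal k * ball_norm d M \<phi> x r"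
      by (rule mult_left_mono) simp
    moreover have "ennreal k * (ball_norm d M \<phi> x (s * r) / ennreal k) = ball_norm d M \<phi> x (s * r)"
      using k by (simp add: ennreal_times_divide mult.commute[of "ennreal k"] mult_divide_eq_ennreal)
    ultimately show "ball_norm d M \<phi> x (s * r)
        \<le> ennreal (c * s powr (n * p\<^sub>1 / p)) * ball_norm d M \<phi> x r"
      by (simp add: k_def)
  qed
qed

section \<open>Averages and oscillation over nested balls\<close>

text \<open>The average of \<open>f\<close> minus \<open>c\<close> is the average of
  \<open>f - c\<close>. Its norm is moved inside the integral and the domain enlarged to
  \<open>B\<close>, while the normalization by the measure of \<open>A\<close> stays. The case of
  interest has the average over \<open>B\<close> as \<open>c\<close>.\<close>

lemma norm_average_diff_le:
  fixes f :: "'a \<Rightarrow> 'b::{banach, second_countable_topology}"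
  assumes A: "A \<in> sets M" "emeasure M A = ennreal a" "0 < a" and B: "B \<in> sets M" "A \<subseteq> B"
    and f: "set_integrable M B f"
  shows "ennreal (norm (average M A f - c)) \<le> (\<integral>\<^sup>+y\<in>B. ennreal (norm (f y - c)) \<partial>M) / ennreal a"
proof -
  have ma: "measure M A = a" using A by (simp add: measure_def)
  have fA: "set_integrable M A f" using set_integrable_subset[OF f A(1) B(2)] .
  have cA: "set_integrable M A (\<lambda>_. c)"
    using A by (simp add: set_integrable_def)
  have int: "set_integrable M A (\<lambda>y. f y - c)" using fA cA by (rule set_integral_diff)
  have "(LINT y:A|M. f y - c) = (LINT y:A|M. f y) - (LINT y:A|M. c)"
    using fA cA by (rule set_integral_diff)
  also have "(LINT y:A|M. c) = a *\<^sub>R c"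
    using A ma by (simp add: set_lebesgue_integral_def)
  finally have "average M A f - c = (1 / a) *\<^sub>R (LINT y:A|M. f y - c)"
    using A by (simp add: average_def ma scaleR_diff_right)
  then have "ennreal (norm (average M A f - c)) = ennreal (norm (LINT y:A|M. f y - c)) / ennreal a"
    using A by (simp add: divide_ennreal)
  also have "ennreal (norm (LINT y:A|M. f y - c)) \<le> (\<integral>\<^sup>+y. ennreal (norm (indicator A y *\<^sub>R (f y - c))) \<partial>M)"
    using int unfolding set_integrable_def set_lebesgue_integral_def
    by (rule integral_norm_bound_ennreal)
  also have "\<dots> \<le> (\<integral>\<^sup>+y\<in>B. ennreal (norm (f y - c)) \<partial>M)"
    using B by (intro nn_integral_mono) (auto simp: indicator_def)
  finally show ?thesis by (simp add: divide_right_mono_ennreal)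
qed

lemma BMO_oscillation_le:
  assumes f: "f \<in> BMO d M \<phi>" and x: "x \<in> space M" and r: "0 < r"
    and fin: "ball_norm d M \<phi> x r < \<infinity>"
  shows "(\<integral>\<^sup>+y\<in>qball d M x r. ennreal (norm (f y - average M (qball d M x r) f)) \<partial>M)
    \<le> bmo_norm d M \<phi> f * ball_norm d M \<phi> x r"
proof -
  let ?I = "\<integral>\<^sup>+y\<in>qball d M x r. ennreal (norm (f y - average M (qball d M x r) f)) \<partial>M"
  have le: "?I / ball_norm d M \<phi> x r \<le> bmo_norm d M \<phi> f"
    unfolding bmo_norm_def Let_def using x r by (intro SUP_upper2[of x] SUP_upper2[of r]) auto
  also have "\<dots> < \<infinity>" using f by (simp add: BMO_def)
  finally have lt: "?I / ball_norm d M \<phi> x r < \<infinity>" .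
  show ?thesis
  proof (cases "ball_norm d M \<phi> x r = 0")
    case True
    \<comment> \<open>In \<open>ennreal\<close> a nonzero value divided by 0 is infinite, so the
      finite quotient forces the oscillation to vanish.\<close>
    then have "?I = 0" using lt by (simp split: if_splits)
    then show ?thesis by simp
  next
    case False
    have "?I = ?I / ball_norm d M \<phi> x r * ball_norm d M \<phi> x r"
      using False fin by (simp add: ennreal_divide_times ennreal_divide_self)
    also have "\<dots> \<le> bmo_norm d M \<phi> f * ball_norm d M \<phi> x r"
      using le by (rule mult_right_mono) simp
    finally show ?thesis .
  qed
qed

lemma BMO_average_step:
  fixes f :: "'a \<Rightarrow> 'b::{banach, second_countable_topology}"
  assumes hom: "space_of_homogeneous_type d M"
    and diam: "0 < qdiam d M"
    and R: "1 \<le> C\<^sub>R" "\<And>x r s. x \<in> space M \<Longrightarrow> 0 < r \<Longrightarrow> 1 \<le> s \<Longrightarrow> ereal (s * r) < 2 * qdiam d M \<Longrightarrow>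
      inverse C\<^sub>R * s powr \<alpha> * measure M (qball d M x r) \<le> measure M (qball d M x (s * r))"
    and c: "0 < c" "\<And>x r. x \<in> space M \<Longrightarrow> 0 < r \<Longrightarrow> ball_norm d M \<phi> x r < \<infinity>"
    "\<And>x r s. x \<in> space M \<Longrightarrow> 0 < r \<Longrightarrow> 1 \<le> s \<Longrightarrow>
      ball_norm d M \<phi> x (s * r) \<le> ennreal (c * s powr \<gamma>) * ball_norm d M \<phi> x r"
    and \<gamma>: "0 \<le> \<gamma>"
    and f: "f \<in> BMO d M \<phi>" and x: "x \<in> space M" and r: "0 < r"
    and s: "1 \<le> s" and l: "1 < l" "l \<le> 2"
  shows "norm (average M (qball d M x (s * r)) f - average M (qball d M x (s * l * r)) f)
    \<le> C\<^sub>R * c * 2 powr \<gamma> *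
      (enn2real (ball_norm d M \<phi> x r) / measure M (qball d M x r) * enn2real (bmo_norm d M \<phi> f)) *
      s powr (\<gamma> - \<alpha>)"
proof (cases "ereal (s * r) < 2 * qdiam d M")
  case True
  note ball = space_of_homogeneous_type_qball[OF hom x]
  have sl: "1 \<le> s * l" using s l by (metis less_imp_le mult_mono mult_1 zero_le_one order_trans)
  have sr: "0 < s * r" "0 < s * l * r" "s * r \<le> s * l * r" using s l r by auto
  define N where "N = enn2real (ball_norm d M \<phi> x r)"
  define b where "b = enn2real (bmo_norm d M \<phi> f)"
  define m where "m = measure M (qball d M x r)"
  define m' where "m' = measure M (qball d M x (s * r))"
  have N: "ball_norm d M \<phi> x r = ennreal N" "0 \<le> N"
    using c(2)[OF x r] by (auto simp: N_def)
  have b: "bmo_norm d M \<phi> f = ennreal b" "0 \<le> b"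
    using f by (auto simp: b_def BMO_def)
  have m: "0 < m" "0 < m'" using ball(3)[OF r] ball(3)[OF sr(1)] by (auto simp: m_def m'_def)
  let ?D = "norm (average M (qball d M x (s * r)) f - average M (qball d M x (s * l * r)) f)"
  have fi: "set_integrable M (qball d M x (s * l * r)) f"
    using f x sr by (auto simp: BMO_def)
  have "ennreal ?D \<le> (\<integral>\<^sup>+y\<in>qball d M x (s * l * r).
      ennreal (norm (f y - average M (qball d M x (s * l * r)) f)) \<partial>M) / ennreal m'"
    unfolding m'_def
    by (rule norm_average_diff_le[OF ball(1,2,3)[OF sr(1)] ball(1)[OF sr(2)] qball_mono[OF sr(3)] fi])
  also have "\<dots> \<le> bmo_norm d M \<phi> f * ball_norm d M \<phi> x (s * l * r) / ennreal m'"
    by (intro divide_right_mono_ennreal BMO_oscillation_le[OF f x sr(2) c(2)[OF x sr(2)]])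
  also have "\<dots> \<le> ennreal b * (ennreal (c * (s * l) powr \<gamma>) * ennreal N) / ennreal m'"
    using c(3)[OF x r sl] N b by (intro divide_right_mono_ennreal mult_mono) auto
  also have "\<dots> = ennreal (b * (c * (s * l) powr \<gamma> * N) / m')"
    using b c(1) N m by (simp add: ennreal_mult[symmetric] divide_ennreal)
  finally have "?D \<le> b * (c * (s * l) powr \<gamma> * N) / m'"
    using b c(1) N m by (subst (asm) ennreal_le_iff) auto
  \<comment> \<open>Bounding \<open>l\<close> by 2 makes the cost depend on \<open>s\<close>
    alone.\<close>
  also have "\<dots> \<le> b * (c * (s * 2) powr \<gamma> * N) / m'"
    using b c(1) N m \<gamma> s l by (intro divide_right_mono mult_left_mono mult_right_mono powr_mono2) auto
  \<comment> \<open>Reverse doubling from the original ball to its \<open>s\<close>-fold supplies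
    the gain \<open>s powr \<alpha>\<close> in the denominator.\<close>
  also have "\<dots> \<le> b * (c * (s * 2) powr \<gamma> * N) / (inverse C\<^sub>R * s powr \<alpha> * m)"
    using R(1) R(2)[OF x r s True] b c(1) N m s
    by (intro divide_left_mono) (auto simp: m_def m'_def)
  also have "\<dots> = C\<^sub>R * c * 2 powr \<gamma> * (N / m * b) * s powr (\<gamma> - \<alpha>)"
    using R(1) s m by (simp add: powr_mult powr_diff field_simps)
  finally show ?thesis by (simp add: N_def b_def m_def)
next
  case False
  \<comment> \<open>Twice the diameter is at most \<open>s * r\<close>, and positivity of the
    diameter makes the inequality for the diameter itself strict. Both balls are then the whole
    space and the averages agree.\<close>
  have "qdiam d M < ereal (s * r)"
    using False diam by (cases "qdiam d M") auto
  moreover have "s * r \<le> s * l * r" using s l r by auto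
  ultimately have "qdiam d M < ereal (s * r)" "qdiam d M < ereal (s * l * r)"
    by (auto intro: less_le_trans)
  then have "qball d M x (s * r) = space M" "qball d M x (s * l * r) = space M"
    by (simp_all add: qball_eq_space[OF x])
  then show ?thesis using R(1) c(1) by (simp add: measure_nonneg)
qed

section \<open>Choice of exponents and constants\<close>

theorem proposition2p14:
  fixes d :: "'a \<Rightarrow> 'a \<Rightarrow> real" and M :: "'a measure"
    and \<phi> :: "'a \<Rightarrow> real \<Rightarrow> real"
    and \<alpha>\<^sub>0 n\<^sub>0 N\<^sub>0 :: ereal and n \<alpha> p\<^sub>1 p :: real
  assumes "space_of_homogeneous_type d M"
    and "homogeneous_degree d M = (\<alpha>\<^sub>0, n\<^sub>0, N\<^sub>0)"
    and "n\<^sub>0 < ereal n"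
    and "\<alpha>\<^sub>0 > 0 \<Longrightarrow> 0 < \<alpha> \<and> ereal \<alpha> < \<alpha>\<^sub>0"
    and "\<alpha>\<^sub>0 = 0 \<Longrightarrow> \<alpha> = 0"
    and "growth_function d M \<phi>"
    and "1 \<le> p\<^sub>1" and "\<phi> \<in> muckenhoupt d M p\<^sub>1"
    and "0 < p" and "p \<le> 1" and "unif_lower_type M \<phi> p"
  shows "\<exists>C::real. 0 < C \<and>
    (\<forall>f::'a \<Rightarrow> 'b::{real_normed_field, banach, second_countable_topology}. f \<in> BMO d M \<phi> \<longrightarrow>
      (\<forall>x\<in>space M. \<forall>r>0. \<forall>K>1.
        ennreal (norm (average M (qball d M x r) f - average M (qball d M x (K * r)) f))
        \<le> ennreal (C * K powr (n * p\<^sub>1 / p - \<alpha>)) *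
           (ball_norm d M \<phi> x r / emeasure M (qball d M x r)) * bmo_norm d M \<phi> f))"
\<comment> \<open>On a one-point space reverse doubling is vacuous, so \<alpha> is not bounded by
  \<open>n\<close> and the power of \<open>K\<close> may be negative. There all concentric balls
  coincide and the left side is 0.\<close>
proof (cases "0 < qdiam d M \<and> space M \<noteq> {}")
  case False
  have "qball d M x (K * r) = qball d M x r" if "x \<in> space M" "0 < r" "1 < K" for x r K
  proof -
    have "qdiam d M \<le> 0" using False that by auto
    moreover have "0 < K * r" using that by simp
    ultimately show ?thesis using that qball_eq_space[OF that(1), of d]
      by (metis ereal_less(2) le_less_trans)
  qed
  then show ?thesis by (intro exI[of _ 1]) auto
next
  case True
  then obtain x\<^sub>0 where x0: "x\<^sub>0 \<in> space M" and diam: "0 < qdiam d M" by auto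
  note hom = assms(1)
  define \<gamma> where "\<gamma> = n * p\<^sub>1 / p"
  have deg: "\<alpha>\<^sub>0 = degree_R d M" "n\<^sub>0 = degree_D d M"
    using assms(2) by (auto simp: homogeneous_degree_def)
  obtain n' where n': "cond_D d M n'" "n' < n"
    using assms(3) unfolding deg degree_D_def INF_less_iff by auto
  have D: "cond_D d M n" using cond_D_mono n' by (meson less_imp_le)
  have R0: "cond_R d M 0" using cond_R_0[OF hom D] .
  \<comment> \<open>Nonnegativity guarantees that one of the two hypotheses on \<alpha>
    applies.\<close>
  then have "0 \<le> \<alpha>\<^sub>0" unfolding deg degree_R_def by (intro SUP_upper2[of 0]) auto
  then consider "\<alpha>\<^sub>0 = 0" | "0 < \<alpha>\<^sub>0" by (auto simp: le_less)
  then have R: "cond_R d M \<alpha>"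
  proof cases
    case 1 then show ?thesis using R0 assms(5) by simp
  next
    case 2
    then have \<alpha>: "0 < \<alpha>" "ereal \<alpha> < \<alpha>\<^sub>0" using assms(4) by auto
    then obtain \<alpha>' where "cond_R d M \<alpha>'" "\<alpha> < \<alpha>'"
      unfolding deg degree_R_def less_SUP_iff by auto
    then show ?thesis using cond_R_antimono \<alpha> by (meson less_imp_le)
  qed
  \<comment> \<open>Comparing exponents gives only \<open>\<alpha> \<le> n'\<close>; strictness
    comes from the room between \<open>n'\<close> and \<open>n\<close>.\<close>
  have "\<alpha> < n" using cond_R_le_cond_D[OF hom x0 R n'(1) diam] n'(2) by simp
  have n: "0 < n" using D by (simp add: cond_D_def)
  have "n * p \<le> n * p\<^sub>1" using n assms(7,10) by (intro mult_left_mono) auto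
  then have "n \<le> \<gamma>" using assms(9) by (simp add: \<gamma>_def le_divide_eq)
  with \<open>\<alpha> < n\<close> n have \<beta>: "0 < \<gamma> - \<alpha>" and \<gamma>: "0 \<le> \<gamma>" by auto
  obtain C\<^sub>R where CR: "1 \<le> C\<^sub>R" "\<And>x r s. x \<in> space M \<Longrightarrow> 0 < r \<Longrightarrow> 1 \<le> s \<Longrightarrow>
      ereal (s * r) < 2 * qdiam d M \<Longrightarrow>
      inverse C\<^sub>R * s powr \<alpha> * measure M (qball d M x r) \<le> measure M (qball d M x (s * r))"
    using R ereal_reverse_doubling_range unfolding cond_R_def by metis
  obtain c where c: "0 < c" "\<And>x r. x \<in> space M \<Longrightarrow> 0 < r \<Longrightarrow> ball_norm d M \<phi> x r < \<infinity>"
    "\<And>x r s. x \<in> space M \<Longrightarrow> 0 < r \<Longrightarrow> 1 \<le> s \<Longrightarrow>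
      ball_norm d M \<phi> x (s * r) \<le> ennreal (c * s powr \<gamma>) * ball_norm d M \<phi> x r"
    using ball_norm_doubling[OF hom D assms(6-9,11)] unfolding \<gamma>_def by metis
  define C\<^sub>1 where "C\<^sub>1 = C\<^sub>R * c * 2 powr \<gamma>"
  define C where "C = C\<^sub>1 / (1 - 2 powr - (\<gamma> - \<alpha>))"
  have C1: "0 < C\<^sub>1" using CR(1) c(1) by (simp add: C\<^sub>1_def)
  have "(2::real) powr - (\<gamma> - \<alpha>) < 1" using \<beta> by (intro powr_less_one) auto
  then have C: "0 < C" using C1 by (simp add: C_def)
  have "ennreal (norm (average M (qball d M x r) f - average M (qball d M x (K * r)) f))
      \<le> ennreal (C * K powr (\<gamma> - \<alpha>)) *
         (ball_norm d M \<phi> x r / emeasure M (qball d M x r)) * bmo_norm d M \<phi> f"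
    if f: "f \<in> BMO d M \<phi>" and x: "x \<in> space M" and r: "0 < r" and K: "1 < K"
    for f :: "'a \<Rightarrow> 'b" and x r K
  proof -
    note ball = space_of_homogeneous_type_qball[OF hom x r]
    \<comment> \<open>Both norms are finite, so nothing is lost in passing to real numbers.\<close>
    define N where "N = enn2real (ball_norm d M \<phi> x r)"
    define b where "b = enn2real (bmo_norm d M \<phi> f)"
    define m where "m = measure M (qball d M x r)"
    have N: "ball_norm d M \<phi> x r = ennreal N" "0 \<le> N"
      using c(2)[OF x r] by (auto simp: N_def)
    have b: "bmo_norm d M \<phi> f = ennreal b" "0 \<le> b"
      using f by (auto simp: b_def BMO_def)
    have m: "emeasure M (qball d M x r) = ennreal m" "0 < m" using ball by (auto simp: m_def)
    let ?F = "\<lambda>s. average M (qball d M x (s * r)) f"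
    \<comment> \<open>The norms enter through the step constant, so the geometric sum leaves
      \<open>C\<close> independent of \<open>f\<close>, the ball and \<open>K\<close>.\<close>
    have "norm (?F 1 - ?F K) \<le> C\<^sub>1 * (N / m * b) / (1 - 2 powr - (\<gamma> - \<alpha>)) * K powr (\<gamma> - \<alpha>)"
    proof (rule norm_diff_le_of_dyadic_steps[OF _ \<beta> _ K])
      show "norm (?F s - ?F (s * l)) \<le> C\<^sub>1 * (N / m * b) * s powr (\<gamma> - \<alpha>)"
        if "1 \<le> s" "1 < l" "l \<le> 2" for s l
        unfolding C\<^sub>1_def N_def m_def b_def
        by (rule BMO_average_step[OF hom diam CR c \<gamma> f x r that])
    qed (use C1 N m b in auto)
    also have "\<dots> = C * K powr (\<gamma> - \<alpha>) * (N / m) * b"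
      by (simp add: C_def mult_ac)
    finally have "ennreal (norm (?F 1 - ?F K)) \<le> ennreal (C * K powr (\<gamma> - \<alpha>) * (N / m) * b)"
      by (rule ennreal_leI)
    also have "\<dots> = ennreal (C * K powr (\<gamma> - \<alpha>)) *
         (ball_norm d M \<phi> x r / emeasure M (qball d M x r)) * bmo_norm d M \<phi> f"
      using C N m b by (simp add: divide_ennreal ennreal_mult[symmetric])
    finally show ?thesis by simp
  qed
  then show ?thesis using C unfolding \<gamma>_def by blast
qed

end
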